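(* Let $j$ be an even positive integer, let $m$ be an integer with $1 \leq m \leq j-3$, let $k = m(j+1)+3$, and let $D = \{1,j,k\}$. Then \[ \mu(D) = \kappa(D) = \frac{j(m+1)}{2(j+k)}. \]
   Context: For a set $D$ of positive integers, a $D$-sequence is a set $S$ of nonnegative integers such that $|x-y| \notin D$ for all $x,y \in S$. For $N \geq 0$ write $S[N] = |S \cap \{0,1,\dots,N\}|$. The upper and lower densities of $S$ are $\limsup_{N\to\infty} S[N]/(N+1)$ and $\liminf_{N\to\infty} S[N]/(N+1)$; if they coincide, the common value is the density $\delta(S)$. Define $\mu(D) = \sup\{\delta(S) : S \text{ is a } D\text{-sequence having a density}\}$. For a real $x$, $\|x\|$ denotes the distance from $x$ to the nearest integer, and $\kappa(D) = \sup_{t \in \mathbb{R}} \min_{d \in D} \|td\|$. *)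

theory Defs
  imports Complex_Main "HOL-Library.Extended_Real" "HOL-Library.Liminf_Limsup"
begin

definition D_sequence :: "nat set \<Rightarrow> nat set \<Rightarrow> bool" where
  "D_sequence D S \<longleftrightarrow> (\<forall>x\<in>S. \<forall>y\<in>S. nat \<bar>int x - int y\<bar> \<notin> D)"

definition counting :: "nat set \<Rightarrow> nat \<Rightarrow> nat" where
  "counting S N = card (S \<inter> {0..N})"

definition upper_density :: "nat set \<Rightarrow> ereal" where
  "upper_density S = limsup (\<lambda>N. ereal (real (counting S N) / (real N + 1)))"

definition lower_density :: "nat set \<Rightarrow> ereal" where
  "lower_density S = liminf (\<lambda>N. ereal (real (counting S N) / (real N + 1)))"

definition has_density :: "nat set \<Rightarrow> bool" where
  "has_density S \<longleftrightarrow> upper_density S = lower_density S"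

text \<open>The quotients lie in \<open>[0, 1]\<close>, so the conversion from \<^typ>\<open>ereal\<close> loses nothing.
  The value is meaningful only when \<^const>\<open>has_density\<close> holds.\<close>

definition natural_density :: "nat set \<Rightarrow> real" where
  "natural_density S = real_of_ereal (upper_density S)"

definition mu :: "nat set \<Rightarrow> real" where
  "mu D = Sup {natural_density S | S. D_sequence D S \<and> has_density S}"

definition dist_nearest_int :: "real \<Rightarrow> real" where
  "dist_nearest_int x = \<bar>x - of_int (round x)\<bar>"

text \<open>Because of \<^const>\<open>Min\<close>, this is meaningful only for finite nonempty \<open>D\<close>.\<close>

definition kappa :: "nat set \<Rightarrow> real" where
  "kappa D = (SUP t::real. Min ((\<lambda>d. dist_nearest_int (t * real d)) ` D))"

end

theory Submission
  imports Defs "HOL-Number_Theory.Cong"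
begin

text \<open>
  Put \<open>n = j + k = (m + 1) (j + 1) + 2\<close> and \<open>c = (m + 1) j / 2\<close>. Any \<open>j + 1\<close> consecutive integers
  form an odd cycle under the differences \<open>1\<close> and \<open>j\<close>, so they contain at most \<open>j / 2\<close> elements of a
  D-sequence \<open>S\<close>. If \<open>0 \<in> S\<close> and \<open>S\<close> had more than \<open>c\<close> elements in \<open>[0, n)\<close>, every
  block \<open>[a (j + 1), (a + 1) (j + 1))\<close> with \<open>a \<le> m\<close> would be full, that is, alternating up to one
  longer gap. The difference \<open>j\<close> lets this gap move by at most two places from one block to the next
  (four in the single exceptional step), while the difference \<open>k\<close> forces it to travel almost twice
  around the cycle between block \<open>0\<close> and block \<open>m\<close>, which takes at least \<open>j - 2\<close> steps.
  Hence each window of length \<open>n\<close> that starts in \<open>S\<close> has at most \<open>c\<close> elements and \<open>\<mu> \<le> c / n\<close>.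
  A number \<open>t\<close> with all \<open>\<parallel>t d\<parallel> \<ge> \<beta>\<close> yields D-sequences of average density about \<open>\<beta>\<close> by rotation,
  so \<open>\<kappa> \<le> c / n\<close> as well, and \<open>t = (c + 1) / n\<close> attains both bounds.
\<close>

section \<open>Counting elements in windows\<close>

definition cnt :: "nat set \<Rightarrow> nat \<Rightarrow> nat \<Rightarrow> nat" where
  "cnt S x l = card (S \<inter> {x..<x + l})"

lemma cnt_0 [simp]: "cnt S x 0 = 0"
  by (simp add: cnt_def)

lemma cnt_add: "cnt S x (a + b) = cnt S x a + cnt S (x + a) b"
proof -
  have "S \<inter> {x..<x + (a + b)} = (S \<inter> {x..<x + a}) \<union> (S \<inter> {x + a..<x + a + b})"
    by auto
  then show ?thesis
    unfolding cnt_def by (simp add: card_Un_disjoint disjoint_iff)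
qed

lemma cnt_1: "cnt S x (Suc 0) = (if x \<in> S then 1 else 0)"
proof -
  have "S \<inter> {x..<x + Suc 0} = (if x \<in> S then {x} else {})"
    by auto
  then show ?thesis by (simp add: cnt_def)
qed

lemma cnt_Suc: "cnt S x (Suc l) = (if x \<in> S then 1 else 0) + cnt S (Suc x) l"
  using cnt_add[of S x "Suc 0" l] by (simp add: cnt_1)

lemma cnt_Suc_right: "cnt S x (Suc l) = cnt S x l + (if x + l \<in> S then 1 else 0)"
  using cnt_add[of S x l "Suc 0"] by (simp add: cnt_1)

lemma cnt_shift: "cnt {y. y + x \<in> S} z l = cnt S (z + x) l"
  by (induction l arbitrary: z) (simp_all add: cnt_Suc)

lemma counting_eq_cnt: "counting S N = cnt S 0 (Suc N)"
  by (simp add: counting_def cnt_def atLeastLessThanSuc_atLeastAtMost)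

section \<open>Pairs and odd cycles from the differences 1 and 2h\<close>

locale one_even_free =
  fixes S :: "nat set" and h :: nat
  assumes one_free: "x \<in> S \<Longrightarrow> Suc x \<notin> S"
    and even_free: "x \<in> S \<Longrightarrow> x + 2 * h \<notin> S"
begin

lemma cnt_pairs_le: "cnt S x (2 * r) \<le> r"
proof (induction r arbitrary: x)
  case (Suc r)
  then show ?case using Suc[of "Suc (Suc x)"] one_free[of x] by (auto simp: cnt_Suc intro: le_SucI)
qed simp

text \<open>An empty pair would leave only \<open>r - 1\<close> pairs, each with at most one
  element.\<close>

lemma cnt_pairs_full:
  assumes "r \<le> cnt S x (2 * r)" "i < r"
  shows "x + 2 * i \<in> S \<or> x + 2 * i + 1 \<in> S"
proof (rule ccontr)
  assume *: "\<not> ?thesis"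
  have "2 * r = 2 * i + (2 + 2 * (r - Suc i))" using assms by simp
  then have "cnt S x (2 * r) = cnt S x (2 * i) + (cnt S (x + 2 * i) 2 + cnt S (x + 2 * i + 2) (2 * (r - Suc i)))"
    by (simp only: cnt_add)
  moreover have "cnt S (x + 2 * i) 2 = 0"
    using * by (simp add: numeral_2_eq_2 cnt_Suc)
  ultimately show False
    using assms cnt_pairs_le[of x i] cnt_pairs_le[of "x + 2 * i + 2" "r - Suc i"] by linarith
qed

text \<open>Joined by the differences \<open>1\<close> and \<open>2 * h\<close>, a block of \<open>2 * h + 1\<close> consecutive
  integers is an odd cycle.\<close>

lemma cnt_block_le: "cnt S x (2 * h + 1) \<le> h"
proof (cases "x \<in> S")
  case True
  then show ?thesis using cnt_pairs_le[of x h] even_free[of x] by (simp add: cnt_Suc_right)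
next
  case False
  then show ?thesis using cnt_pairs_le[of "Suc x" h] by (simp add: cnt_Suc)
qed

lemma cnt_blocks_le: "cnt S x (a * (2 * h + 1)) \<le> a * h"
proof (induction a arbitrary: x)
  case (Suc a)
  have "cnt S x (Suc a * (2 * h + 1)) = cnt S x (2 * h + 1) + cnt S (x + (2 * h + 1)) (a * (2 * h + 1))"
    by (simp only: mult_Suc cnt_add)
  also have "\<dots> \<le> h + a * h"
    by (intro add_mono Suc cnt_block_le)
  finally show ?case by simp
qed simp

end

section \<open>Impossibility of an overfull window\<close>

text \<open>A D-sequence that is too dense on a window of length \<open>j + k\<close>, where \<open>j = 2 * h\<close>.\<close>

locale overfull_window = one_even_free +
  fixes m :: nat
  assumes k_free: "x \<in> S \<Longrightarrow> x + (m * (2 * h + 1) + 3) \<notin> S"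
    and zero_in: "0 \<in> S"
    and m_le: "m + 3 \<le> 2 * h"
    and overfull: "Suc m * h < cnt S 0 (Suc m * (2 * h + 1) + 2)"
begin

definition blk :: "nat \<Rightarrow> nat" where "blk a = a * (2 * h + 1)"

lemma blk_0: "blk 0 = 0" and blk_Suc: "blk (Suc a) = blk a + 2 * h + 1"
  by (simp_all add: blk_def)

lemma h_ge: "2 \<le> h" using m_le by simp

text \<open>Deleting these two points from the window leaves \<open>m + 1\<close> blocks.\<close>

lemma start_or_second:
  assumes "a \<le> b" "b \<le> Suc m"
  shows "blk a \<in> S \<or> blk b + 1 \<in> S"
proof (rule ccontr)
  assume *: "\<not> ?thesis"
  let ?L = "2 * h + 1"
  have "Suc m = a + ((b - a) + (Suc m - b))" using assms by simp
  then have M: "Suc m * ?L = a * ?L + ((b - a) * ?L + (Suc m - b) * ?L)"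
    "Suc m * h = a * h + ((b - a) * h + (Suc m - b) * h)"
    by (metis add_mult_distrib)+
  have b: "blk b = blk a + (b - a) * ?L"
    unfolding blk_def using assms by (metis add_mult_distrib le_add_diff_inverse)
  have "Suc m * ?L + 2 = a * ?L + (Suc 0 + ((b - a) * ?L + (Suc 0 + (Suc m - b) * ?L)))"
    using M by simp
  then have "cnt S 0 (Suc m * ?L + 2) = cnt S 0 (a * ?L) + (cnt S (blk a) (Suc 0)
      + (cnt S (blk a + 1) ((b - a) * ?L) + (cnt S (blk b + 1) (Suc 0) + cnt S (blk b + 2) ((Suc m - b) * ?L))))"
    by (simp only: cnt_add b) (simp add: blk_def add.commute add.left_commute)
  also have "\<dots> \<le> a * h + (0 + ((b - a) * h + (0 + (Suc m - b) * h)))"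
    using * by (intro add_mono cnt_blocks_le) (simp_all add: cnt_1)
  finally show False using overfull M(2) by linarith
qed

text \<open>Removing this block and the two points after it leaves \<open>m\<close> blocks with at
  most \<open>h\<close> elements each. The two points are consecutive and hold at most one element,
  so at least \<open>h\<close> remain for this block.\<close>

lemma block_full:
  assumes "a \<le> m"
  shows "h \<le> cnt S (blk a) (2 * h + 1)"
proof -
  let ?L = "2 * h + 1"
  have "Suc m = a + (1 + (m - a))" using assms by simp
  then have M: "Suc m * ?L = a * ?L + (1 * ?L + (m - a) * ?L)"
    "Suc m * h = a * h + (1 * h + (m - a) * h)"
    by (metis add_mult_distrib)+
  have "Suc m * ?L + 2 = a * ?L + (?L + (2 * 1 + (m - a) * ?L))"
    using M by simp
  then have "cnt S 0 (Suc m * ?L + 2) = cnt S 0 (a * ?L) + (cnt S (blk a) ?L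
      + (cnt S (blk a + ?L) (2 * 1) + cnt S (blk a + ?L + 2 * 1) ((m - a) * ?L)))"
    by (simp only: cnt_add blk_def add_0)
  also have "\<dots> \<le> a * h + (cnt S (blk a) ?L + (1 + (m - a) * h))"
    by (intro add_mono cnt_blocks_le cnt_pairs_le order_refl)
  finally show ?thesis using overfull M by linarith
qed

text \<open>The start excludes the last point of the block through the difference
  \<open>2 * h\<close>, so all \<open>h\<close> elements lie in the pairs (0,1), (2,3), ... If the
  start is missing, \<open>odd_pair\<close> uses (1,2), (3,4), ... instead.\<close>

lemma even_pair:
  assumes "a \<le> m" "blk a \<in> S" "i < h"
  shows "blk a + 2 * i \<in> S \<or> blk a + 2 * i + 1 \<in> S"
  using block_full[OF assms(1)] even_free[OF assms(2)] assms(3)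
  by (intro cnt_pairs_full[of h]) (simp_all add: cnt_Suc_right)

lemma odd_pair:
  assumes "a \<le> m" "blk a \<notin> S" "i < h"
  shows "blk a + 2 * i + 1 \<in> S \<or> blk a + 2 * i + 2 \<in> S"
  using block_full[OF assms(1)] assms(2,3) cnt_pairs_full[of h "Suc (blk a)" i]
  by (simp add: cnt_Suc)

text \<open>A block is one longer than the difference \<open>2 * h\<close>, so this difference leads
  into the next block one position lower.\<close>

lemma next_block: "blk a + Suc x \<in> S \<Longrightarrow> blk (Suc a) + x \<notin> S"
  using even_free[of "blk a + Suc x"] by (simp add: blk_Suc algebra_simps)

lemma plus_k: "x \<in> S \<Longrightarrow> blk m + (x + 3) \<notin> S"
  using k_free[of x] by (simp add: blk_def algebra_simps)

text \<open>Otherwise every block starts in \<open>S\<close>. The first odd position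
  \<open>2 * e + 1\<close> in block 0 then survives into every block, while k =
  \<open>blk m + 3\<close> carries \<open>2 * (e - 1)\<close> onto that very position of block
  \<open>m\<close>.\<close>

lemma last_start_notin: "blk (Suc m) \<notin> S"
proof
  assume last: "blk (Suc m) \<in> S"
  have start: "blk a \<in> S" if "a \<le> Suc m" for a
    using start_or_second[OF that] one_free[OF last] by simp
  \<comment> \<open>Adding k to \<open>2 * (h - 1)\<close> gives \<open>blk (Suc m)\<close>; hence
    some odd position occurs and \<open>e\<close> exists.\<close>
  have "2 * (h - 1) \<notin> S"
  proof
    assume "2 * (h - 1) \<in> S"
    from plus_k[OF this] have "blk (Suc m) \<notin> S" using h_ge by (simp add: blk_Suc algebra_simps)
    with last show False by simp
  qed
  then have "2 * (h - 1) + 1 \<in> S"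
    using even_pair[of 0 "h - 1"] start[of 0] h_ge by (auto simp: blk_0)
  then have ex: "\<exists>e. 2 * e + 1 \<in> S" by blast
  define e where "e = (LEAST e. 2 * e + 1 \<in> S)"
  have e: "2 * e + 1 \<in> S" unfolding e_def by (rule LeastI_ex[OF ex])
  have e_min: "2 * i + 1 \<notin> S" if "i < e" for i
    using that not_less_Least unfolding e_def by blast
  have "e \<le> h - 1"
    unfolding e_def using \<open>2 * (h - 1) + 1 \<in> S\<close> by (rule Least_le)
  have "e \<noteq> 0" using e one_free[OF zero_in] by (intro notI) simp
  have "blk a + 2 * e + 1 \<in> S" if "a \<le> m" for a
    using that
  proof (induction a)
    case 0
    then show ?case using e by (simp add: blk_0)
  next
    case (Suc a)
    then have "blk (Suc a) + 2 * e \<notin> S" using next_block[of a "2 * e"] by simp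
    then show ?case
      using even_pair[of "Suc a" e] start[of "Suc a"] Suc.prems \<open>e \<le> h - 1\<close> h_ge by auto
  qed
  then have "blk m + 2 * e + 1 \<in> S" by simp
  moreover have "2 * (e - 1) \<in> S"
    using even_pair[of 0 "e - 1"] start[of 0] e_min[of "e - 1"] \<open>e \<noteq> 0\<close> \<open>e \<le> h - 1\<close> h_ge
    by (auto simp: blk_0)
  from plus_k[OF this] have "blk m + 2 * e + 1 \<notin> S"
    using \<open>e \<noteq> 0\<close> by (cases e) (simp_all add: numeral_3_eq_3)
  ultimately show False by simp
qed

lemma inconsistent: False
proof -
  have last: "blk (Suc m) + 1 \<in> S"
    using start_or_second[of "Suc m" "Suc m"] last_start_notin by simp
  \<comment> \<open>The pairing switches at block \<open>g\<close>: earlier blocks obey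
    \<open>even_pair\<close>; from \<open>g\<close> on the second point is in \<open>S\<close>,
    hence the start is not, and \<open>odd_pair\<close> applies.\<close>
  define g where "g = (LEAST a. blk a \<notin> S)"
  have g_out: "blk g \<notin> S" unfolding g_def using last_start_notin by (rule LeastI)
  have below: "blk a \<in> S" if "a < g" for a
    using that not_less_Least unfolding g_def by blast
  have above: "blk a + 1 \<in> S" if "g \<le> a" "a \<le> Suc m" for a
    using start_or_second[OF that] g_out by simp
  have "g \<noteq> 0" using g_out zero_in by (intro notI) (simp add: blk_0)
  then obtain p where p: "g = Suc p" by (cases g) auto
  have three: "blk m + 3 \<notin> S" using plus_k[OF zero_in] by simp
  have "blk m + 2 \<notin> S"
  proof
    assume "blk m + 2 \<in> S"
    from even_free[OF this] last show False by (simp add: blk_Suc algebra_simps)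
  qed
  then have "blk m \<notin> S" using even_pair[of m 1] three h_ge by (auto simp: numeral_3_eq_3)
  then have "g \<le> m" using below[of m] by linarith

  \<comment> \<open>Block 0 is 0, 2, ..., 2h - 2, found downwards: adding k to 2h - 1 gives
    \<open>blk (Suc m) + 1\<close>.\<close>
  have first_evens: "2 * (h - 1 - i) \<in> S" if "i < h" for i
    using that
  proof (induction i)
    case 0
    have "2 * (h - 1) + 1 \<notin> S"
    proof
      assume "2 * (h - 1) + 1 \<in> S"
      from plus_k[OF this] last h_ge show False by (simp add: blk_Suc algebra_simps)
    qed
    then show ?case using even_pair[of 0 "h - 1"] zero_in h_ge by (auto simp: blk_0)
  next
    case (Suc i)
    define r where "r = h - 1 - Suc i"
    have "h - 1 - i = Suc r" using Suc.prems by (simp add: r_def)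
    then have "2 * r + 1 \<notin> S" using Suc one_free[of "2 * r + 1"] by auto
    then show ?case
      using even_pair[of 0 r] zero_in Suc.prems unfolding r_def[symmetric]
      by (auto simp: blk_0 r_def)
  qed
  \<comment> \<open>Position \<open>2 * i + 2\<close> of one block excludes \<open>2 * i + 1\<close>
    in the next, so the known even run loses at most its last pair per step.\<close>
  have evens: "blk a + 2 * i \<in> S" if "a < g" "i + a < h" for a i
    using that
  proof (induction a arbitrary: i)
    case 0
    then show ?case using first_evens[of "h - 1 - i"] by (simp add: blk_0)
  next
    case (Suc a)
    have "blk a + 2 * Suc i \<in> S" using Suc.prems by (intro Suc.IH) auto
    then have "blk (Suc a) + 2 * i + 1 \<notin> S" using next_block[of a "2 * i + 1"] by simp
    then show ?case
      using even_pair[of "Suc a" i] below[of "Suc a"] Suc.prems \<open>g \<le> m\<close> by auto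
  qed

  \<comment> \<open>Positions 2 and 3 of block \<open>m\<close> are missing, so the odd pairs force
    4, 6, ..., 2h.\<close>
  have last_evens: "blk m + 2 * i + 4 \<in> S" if "i + 2 \<le> h" for i
    using that
  proof (induction i)
    case 0
    then show ?case using odd_pair[of m 1] \<open>blk m \<notin> S\<close> three h_ge
      by (auto simp: numeral_3_eq_3 numeral_eq_Suc)
  next
    case (Suc i)
    then have "blk m + 2 * Suc i + 3 \<notin> S" using one_free[of "blk m + 2 * i + 4"]
      by (simp add: algebra_simps numeral_eq_Suc)
    then show ?case
      using odd_pair[of m "Suc (Suc i)"] \<open>blk m \<notin> S\<close> Suc.prems by (auto simp: numeral_eq_Suc)
  qed
  \<comment> \<open>The same propagation backwards from block \<open>m\<close>: each step down loses
    at most the lowest pair of the known run.\<close>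
  have late_evens: "blk (m - b) + 2 * i + 4 \<in> S" if "g \<le> m - b" "b \<le> i" "i + 2 \<le> h" for b i
    using that
  proof (induction b arbitrary: i)
    case 0
    then show ?case using last_evens by simp
  next
    case (Suc b)
    define a where "a = m - Suc b"
    have "m - b = Suc a" using Suc.prems \<open>g \<noteq> 0\<close> by (simp add: a_def)
    obtain i' where i: "i = Suc i'" using Suc.prems by (cases i) auto
    have "blk (Suc a) + 2 * i' + 4 \<in> S"
      using Suc.IH[of i'] Suc.prems \<open>m - b = Suc a\<close> i by (auto simp: a_def)
    then have "blk a + 2 * i + 3 \<notin> S" using next_block[of a "2 * i' + 4"] i
      by (auto simp: numeral_eq_Suc)
    moreover have "blk a \<notin> S" using above[of a] one_free[of "blk a"] Suc.prems by (auto simp: a_def)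
    ultimately show ?case
      using odd_pair[of a "Suc i"] Suc.prems unfolding a_def[symmetric]
      by (auto simp: numeral_eq_Suc a_def)
  qed

  have "p < g" "p \<le> m" using p \<open>g \<le> m\<close> by simp_all
  \<comment> \<open>At the switch, position 1 of block \<open>g\<close> excludes position 2 of block
    \<open>p\<close>. The even run \<open>evens\<close> must have ended by then, which takes at
    least \<open>h - 1\<close> steps.\<close>
  have two: "blk p + 2 \<notin> S"
    using next_block[of p 1] above[of g] p \<open>g \<le> m\<close> by (auto simp: numeral_2_eq_2)
  then have "h \<le> 1 + p" using evens[of p 1] p by force
  \<comment> \<open>Block \<open>p\<close> thus contains 3, 5, ..., 2h - 1.\<close>
  have odds: "blk p + 2 * i + 3 \<in> S" if "i + 2 \<le> h" for i
    using that
  proof (induction i)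
    case 0
    then show ?case using even_pair[of p 1] below[of p] two \<open>p < g\<close> \<open>p \<le> m\<close>
      by (auto simp: numeral_eq_Suc)
  next
    case (Suc i)
    then have "blk p + 2 * Suc i + 2 \<notin> S" using one_free[of "blk p + 2 * i + 3"]
      by (simp add: numeral_eq_Suc)
    then show ?case using even_pair[of p "Suc (Suc i)"] below[of p] \<open>p < g\<close> \<open>p \<le> m\<close> Suc.prems
      by (auto simp: numeral_eq_Suc)
  qed
  \<comment> \<open>From \<open>h \<le> g\<close> and \<open>m + 3 \<le> 2 * h\<close> follows
    \<open>m - g \<le> h - 3\<close>. So the run going back from block \<open>m\<close> still
    contains position 2h - 2 of block \<open>g\<close>, which excludes 2h - 1 in block
    \<open>p\<close>. For \<open>h = 2\<close> the bounds already conflict.\<close>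
  show False
  proof (cases "h = 2")
    case True
    with m_le \<open>h \<le> 1 + p\<close> p \<open>g \<le> m\<close> show False by simp
  next
    case False
    then obtain r where r: "h = r + 3" using h_ge by (metis add.commute le_Suc_ex le_neq_implies_less numeral_2_eq_2 numeral_3_eq_3 Suc_leI)
    have "blk (m - (m - g)) + 2 * r + 4 \<in> S"
      using m_le \<open>h \<le> 1 + p\<close> p r \<open>g \<le> m\<close> by (intro late_evens) auto
    then have "blk p + 2 * r + 5 \<notin> S"
      using next_block[of p "2 * r + 4"] p \<open>g \<le> m\<close> by (auto simp: numeral_eq_Suc)
    then show False using odds[of "Suc r"] r by (simp add: numeral_eq_Suc)
  qed
qed

end

section \<open>From windows to intervals of any length\<close>

lemma D_sequenceD:
  assumes "D_sequence D S" "d \<in> D" "x \<in> S"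
  shows "x + d \<notin> S"
proof
  assume "x + d \<in> S"
  with assms have "nat \<bar>int (x + d) - int x\<bar> \<notin> D" unfolding D_sequence_def by blast
  with assms show False by simp
qed

lemma D_sequence_shift: "D_sequence D S \<Longrightarrow> D_sequence D {y. y + x \<in> S}"
  unfolding D_sequence_def
proof (intro ballI)
  fix a b
  assume S: "\<forall>x\<in>S. \<forall>y\<in>S. nat \<bar>int x - int y\<bar> \<notin> D"
    and "a \<in> {y. y + x \<in> S}" "b \<in> {y. y + x \<in> S}"
  then have "nat \<bar>int (a + x) - int (b + x)\<bar> \<notin> D" by blast
  then show "nat \<bar>int a - int b\<bar> \<notin> D" by simp
qed

lemma D_sequence_window_le:
  assumes D: "D_sequence {1, 2 * h, m * (2 * h + 1) + 3} S"
    and m: "m + 3 \<le> 2 * h" and x: "x \<in> S"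
  shows "cnt S x (Suc m * (2 * h + 1) + 2) \<le> Suc m * h"
proof (rule ccontr)
  assume *: "\<not> ?thesis"
  define T where "T = {y. y + x \<in> S}"
  have DT: "D_sequence {1, 2 * h, m * (2 * h + 1) + 3} T"
    unfolding T_def by (rule D_sequence_shift[OF D])
  have "cnt T 0 (Suc m * (2 * h + 1) + 2) = cnt S x (Suc m * (2 * h + 1) + 2)"
    unfolding T_def by (simp only: cnt_shift add_0)
  then have "overfull_window T h m"
    using D_sequenceD[OF DT, of 1] D_sequenceD[OF DT, of "2 * h"]
      D_sequenceD[OF DT, of "m * (2 * h + 1) + 3"] m x *
    by unfold_locales (simp_all add: T_def)
  then show False by (rule overfull_window.inconsistent)
qed

lemma cnt_le: "cnt S x l \<le> l"
  by (induction l) (auto simp: cnt_Suc_right)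

text \<open>Cut off a window whenever the current point is in \<open>S\<close> and skip the point
  otherwise; the final piece shorter than \<open>n\<close> accounts for
  \<open>n * n\<close>.\<close>

lemma cnt_le_of_window:
  assumes window: "\<And>x. x \<in> S \<Longrightarrow> cnt S x n \<le> c" and n: "0 < n"
  shows "n * cnt S x N \<le> c * N + n * n"
proof (induction N arbitrary: x rule: less_induct)
  case (less N)
  show ?case
  proof (cases "N < n")
    case True
    then have "n * cnt S x N \<le> n * n" using cnt_le[of S x N] by (intro mult_le_mono2) simp
    then show ?thesis by linarith
  next
    case False
    show ?thesis
    proof (cases "x \<in> S")
      case True
      obtain l where l: "N = n + l" using False by (metis le_Suc_ex not_less)
      have "cnt S x N \<le> c + cnt S (x + n) l"
        using window[OF True] by (simp add: l cnt_add)
      then have "n * cnt S x N \<le> n * c + n * cnt S (x + n) l"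
        by (metis mult_le_mono2 add_mult_distrib2)
      also have "\<dots> \<le> n * c + (c * l + n * n)"
        using less[of l "x + n"] l n by simp
      finally show ?thesis by (simp add: l algebra_simps)
    next
      case nx: False
      obtain l where l: "N = Suc l" using False n by (cases N) auto
      have "n * cnt S x N = n * cnt S (Suc x) l" using nx by (simp add: l cnt_Suc)
      also have "\<dots> \<le> c * l + n * n" using less[of l "Suc x"] l by simp
      finally show ?thesis by (simp add: l)
    qed
  qed
qed

section \<open>D-sequences from circle rotations\<close>

lemma dist_nearest_int_le: "dist_nearest_int x \<le> \<bar>x - of_int l\<bar>"
  unfolding dist_nearest_int_def by (rule round_diff_minimal)

lemma dist_nearest_int_nonneg: "0 \<le> dist_nearest_int x"
  by (simp add: dist_nearest_int_def)

text \<open>The circle is cut into \<open>Q\<close> cells, and \<open>x\<close> is kept when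
  \<open>t * x\<close> falls into an arc of \<open>B\<close> consecutive cells. The offset
  \<open>z\<close> turns the arc, for later averaging.\<close>

lemma circle_D_sequence:
  fixes t :: real and Q B :: nat and z :: int
  assumes Q: "0 < Q" and B: "\<And>d. d \<in> D \<Longrightarrow> real B \<le> real Q * dist_nearest_int (t * real d)"
  shows "D_sequence D {x. (\<lfloor>real Q * real x * t\<rfloor> + z) mod int Q < int B}"
  unfolding D_sequence_def
proof (intro ballI notI, unfold mem_Collect_eq)
  fix x y :: nat
  define u where "u x = \<lfloor>real Q * real x * t\<rfloor>" for x :: nat
  define v where "v x = (u x + z) mod int Q" for x
  define q where "q x = (u x + z) div int Q" for x
  assume "(\<lfloor>real Q * real x * t\<rfloor> + z) mod int Q < int B"
    "(\<lfloor>real Q * real y * t\<rfloor> + z) mod int Q < int B"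
    and d: "nat \<bar>int x - int y\<bar> \<in> D"
  then have "v x < int B" "v y < int B" by (simp_all add: u_def v_def)
  moreover have "0 \<le> v x" "0 \<le> v y" using Q by (simp_all add: v_def)
  ultimately have v: "\<bar>v x - v y\<bar> \<le> int B - 1" by linarith
  have uv: "u x = int Q * q x + v x - z" for x
    using mult_div_mod_eq[of "int Q" "u x + z"] unfolding q_def v_def by linarith
  have "u x - u y = int Q * (q x - q y) + (v x - v y)"
    using uv[of x] uv[of y] by (simp add: algebra_simps)
  then have diff: "real_of_int (u x) - real_of_int (u y)
      = real Q * of_int (q x - q y) + of_int (v x - v y)"
    by (metis of_int_add of_int_diff of_int_mult of_int_of_nat_eq)
  have "\<bar>real_of_int (v x - v y)\<bar> \<le> real B - 1"
    using v by linarith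
  moreover have "real_of_int (u x) \<le> real Q * real x * t" "real Q * real x * t < real_of_int (u x) + 1"
    "real_of_int (u y) \<le> real Q * real y * t" "real Q * real y * t < real_of_int (u y) + 1"
    unfolding u_def by linarith+
  \<comment> \<open>Residues of kept points differ by at most \<open>B - 1\<close>, and the two
    floors change the difference by less than 1.\<close>
  ultimately have "\<bar>real Q * real x * t - real Q * real y * t - real Q * of_int (q x - q y)\<bar> < real B"
    using diff by linarith
  moreover have "real Q * real x * t - real Q * real y * t - real Q * of_int (q x - q y)
      = real Q * (t * (real x - real y) - of_int (q x - q y))"
    by (simp add: algebra_simps)
  ultimately have lt: "real Q * \<bar>t * (real x - real y) - of_int (q x - q y)\<bar> < real B"
    by (simp add: abs_mult)
  define l where "l = (if y \<le> x then q x - q y else q y - q x)"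
  have "\<bar>t * real (nat \<bar>int x - int y\<bar>) - of_int l\<bar> = \<bar>t * (real x - real y) - of_int (q x - q y)\<bar>"
  proof (cases "y \<le> x")
    case True
    then have "real (nat \<bar>int x - int y\<bar>) = real x - real y" by simp
    then show ?thesis using True by (simp add: l_def)
  next
    case False
    then have "real (nat \<bar>int x - int y\<bar>) = real y - real x" by simp
    then show ?thesis using False by (simp add: l_def algebra_simps abs_minus_commute)
  qed
  then have "dist_nearest_int (t * real (nat \<bar>int x - int y\<bar>)) \<le> \<bar>t * (real x - real y) - of_int (q x - q y)\<bar>"
    by (metis dist_nearest_int_le)
  then have "real Q * dist_nearest_int (t * real (nat \<bar>int x - int y\<bar>)) < real B"
    using lt Q by (meson le_less_trans mult_left_mono of_nat_0_le_iff)
  with B[OF d] show False by simp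
qed

lemma card_rotation:
  fixes z :: int
  assumes "B \<le> Q"
  shows "card {i \<in> {..<Q}. (z + int i) mod int Q < int B} = B"
proof (cases "Q = 0")
  case False
  have "bij_betw (\<lambda>r. nat ((int r - z) mod int Q)) {..<B} {i \<in> {..<Q}. (z + int i) mod int Q < int B}"
    by (rule bij_betw_byWitness[where f' = "\<lambda>i. nat ((z + int i) mod int Q)"])
      (use False assms in \<open>auto simp: mod_simps nat_less_iff\<close>)
  from bij_betw_same_card[OF this] show ?thesis by simp
qed (use assms in simp)

lemma cnt_eq_sum: "cnt S 0 N = (\<Sum>x<N. if x \<in> S then 1 else 0)"
  by (induction N) (simp_all add: cnt_Suc_right)

text \<open>Averaging over the rotations by \<open>i / N\<close> shows that one of the sets
  \<open>circle_D_sequence\<close> provides has at least \<open>B\<close> elements below \<open>N\<close>.\<close>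

lemma uniform_dist_le:
  fixes t \<beta> :: real
  assumes upper: "\<And>S N. D_sequence D S \<Longrightarrow> n * cnt S 0 N \<le> c * N + n * n"
    and n: "0 < n" and \<beta>: "0 \<le> \<beta>" "\<beta> \<le> 1"
    and dist: "\<And>d. d \<in> D \<Longrightarrow> \<beta> \<le> dist_nearest_int (t * real d)"
  shows "\<beta> \<le> real c / real n"
proof -
  \<comment> \<open>The right side collects \<open>n * n\<close> from \<open>upper\<close> and
    \<open>n\<close> from rounding \<open>N * \<beta>\<close> down to \<open>B\<close>; it does not
    depend on \<open>N\<close>.\<close>
  have bound: "real N * (real n * \<beta> - real c) \<le> real (n * n + n)" if N: "0 < N" for N
  proof -
    define B where "B = nat \<lfloor>real N * \<beta>\<rfloor>"
    have B: "real B \<le> real N * \<beta>" "real N * \<beta> < real B + 1"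
      using \<beta> unfolding B_def by (simp_all add: of_nat_nat)
    have "real B \<le> real N" using B(1) \<beta>(2) by (meson mult_left_le of_nat_0_le_iff order_trans)
    then have "B \<le> N" by simp
    define u where "u x = \<lfloor>real N * real x * t\<rfloor>" for x :: nat
    define S where "S i = {x. (u x + int i) mod int N < int B}" for i :: nat
    have "D_sequence D (S i)" for i
      unfolding S_def u_def
    proof (rule circle_D_sequence[OF N])
      fix d assume "d \<in> D"
      then have "real N * \<beta> \<le> real N * dist_nearest_int (t * real d)"
        using dist by (intro mult_left_mono) auto
      with B(1) show "real B \<le> real N * dist_nearest_int (t * real d)" by linarith
    qed
    then have "(\<Sum>i<N. n * cnt (S i) 0 N) \<le> (\<Sum>i<N. c * N + n * n)"
      by (intro sum_mono upper)
    moreover have "(\<Sum>i<N. cnt (S i) 0 N) = N * B"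
    proof -
      \<comment> \<open>Double counting: each \<open>x\<close> lies in exactly \<open>B\<close> of
        the \<open>N\<close> rotated sets.\<close>
      have "(\<Sum>i<N. cnt (S i) 0 N) = (\<Sum>x<N. \<Sum>i<N. if x \<in> S i then 1 else 0)"
        unfolding cnt_eq_sum by (rule sum.swap)
      also have "\<dots> = (\<Sum>x<N. card {i \<in> {..<N}. x \<in> S i})"
        by (simp add: sum.If_cases Int_def)
      also have "\<dots> = (\<Sum>x<N. B)"
        unfolding S_def mem_Collect_eq by (simp only: card_rotation[OF \<open>B \<le> N\<close>])
      finally show ?thesis by simp
    qed
    ultimately have "n * (N * B) \<le> N * (c * N + n * n)"
      by (simp flip: sum_distrib_left)
    then have "N * (n * B) \<le> N * (c * N + n * n)" by (simp only: mult.left_commute)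
    then have "n * B \<le> c * N + n * n" using N by simp
    then have "real n * real B \<le> real c * real N + real n * real n"
      by (metis of_nat_add of_nat_le_iff of_nat_mult)
    moreover have "real n * (real N * \<beta>) \<le> real n * (real B + 1)"
      using B by (intro mult_left_mono) auto
    ultimately show ?thesis by (simp add: algebra_simps)
  qed
  have "real n * \<beta> \<le> real c"
  proof (rule ccontr)
    assume "\<not> ?thesis"
    then have pos: "0 < real n * \<beta> - real c" by simp
    then obtain N where N: "real (n * n + n) < real N * (real n * \<beta> - real c)"
      using reals_Archimedean3 by blast
    have "N \<noteq> 0" using N of_nat_0_le_iff[of "n * n + n"] by (intro notI) (simp del: of_nat_add of_nat_mult)
    then have "0 < N" by simp
    with bound[of N] N show False by simp
  qed
  then show ?thesis using n by (simp add: field_simps)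
qed

section \<open>Density bounds from counting bounds\<close>

lemma tendsto_over_Suc: "(\<lambda>N. a / (real N + 1)) \<longlonglongrightarrow> 0"
proof -
  have "filterlim (\<lambda>N. 1 + real N) at_top sequentially"
    by (rule filterlim_tendsto_add_at_top[OF tendsto_const filterlim_real_sequentially])
  from real_tendsto_divide_at_top[OF tendsto_const this] show ?thesis
    by (simp add: add.commute)
qed

lemma upper_density_le:
  assumes "\<And>N. n * cnt S 0 N \<le> c * N + n * n" and n: "0 < n"
  shows "upper_density S \<le> ereal (real c / real n)"
proof -
  have "real (counting S N) / (real N + 1) \<le> real c / real n + real n / (real N + 1)" for N
  proof -
    have "real n * real (counting S N) \<le> real c * (real N + 1) + real n * real n"
      using assms(1)[of "Suc N"] unfolding counting_eq_cnt
      by (metis of_nat_Suc of_nat_add of_nat_le_iff of_nat_mult add.commute)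
    then have "real (counting S N) \<le> (real c * (real N + 1) + real n * real n) / real n"
      using n by (simp add: pos_le_divide_eq mult.commute)
    also have "\<dots> = (real c / real n + real n / (real N + 1)) * (real N + 1)"
      using n by (simp add: add_divide_distrib distrib_right)
    finally show ?thesis by (simp add: pos_divide_le_eq)
  qed
  then have "upper_density S \<le> limsup (\<lambda>N. ereal (real c / real n + real n / (real N + 1)))"
    unfolding upper_density_def by (intro Limsup_mono) simp
  also have "(\<lambda>N. real c / real n + real n / (real N + 1)) \<longlonglongrightarrow> real c / real n + 0"
    by (intro tendsto_add tendsto_const tendsto_over_Suc)
  then have "limsup (\<lambda>N. ereal (real c / real n + real n / (real N + 1))) = ereal (real c / real n)"
    by (intro lim_imp_Limsup) simp_all
  finally show ?thesis .
qed

lemma lower_density_ge: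
  assumes "\<And>N. c * N \<le> n * cnt S 0 N + n * c" and n: "0 < n"
  shows "ereal (real c / real n) \<le> lower_density S"
proof -
  have "real c / real n - real c / (real N + 1) \<le> real (counting S N) / (real N + 1)" for N
  proof -
    have "real c * (real N + 1) \<le> real n * real (counting S N) + real n * real c"
      using assms(1)[of "Suc N"] unfolding counting_eq_cnt
      by (metis of_nat_Suc of_nat_add of_nat_le_iff of_nat_mult add.commute)
    then have "(real c * (real N + 1) - real n * real c) / real n \<le> real (counting S N)"
      using n by (simp add: pos_divide_le_eq mult.commute)
    moreover have "(real c * (real N + 1) - real n * real c) / real n
        = (real c / real n - real c / (real N + 1)) * (real N + 1)"
      using n by (simp add: diff_divide_distrib left_diff_distrib)
    ultimately show ?thesis by (simp add: pos_le_divide_eq)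
  qed
  then have "liminf (\<lambda>N. ereal (real c / real n - real c / (real N + 1))) \<le> lower_density S"
    unfolding lower_density_def by (intro Liminf_mono) simp
  moreover have "(\<lambda>N. real c / real n - real c / (real N + 1)) \<longlonglongrightarrow> real c / real n - 0"
    by (intro tendsto_diff tendsto_const tendsto_over_Suc)
  then have "liminf (\<lambda>N. ereal (real c / real n - real c / (real N + 1))) = ereal (real c / real n)"
    by (intro lim_imp_Liminf) simp_all
  ultimately show ?thesis by simp
qed

section \<open>The periodic extremal sequence and its angle\<close>

text \<open>Multiplication by \<open>s\<close> permutes the residues modulo
  \<open>n\<close>.\<close>

lemma cnt_multiples_mod:
  assumes cop: "coprime s n" and c: "c \<le> n"
  shows "cnt {x. x * s mod n < c} 0 n = c"
proof (cases "n = 0")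
  case False
  have inj: "inj_on (\<lambda>x. x * s mod n) {..<n}"
  proof (rule inj_onI)
    fix x y assume xy: "x \<in> {..<n}" "y \<in> {..<n}" "x * s mod n = y * s mod n"
    then have "[x * s = y * s] (mod n)" by (simp add: cong_def)
    then have "[x = y] (mod n)" using cop by (simp add: cong_mult_rcancel_nat)
    then show "x = y" using xy by (simp add: cong_def)
  qed
  then have img: "(\<lambda>x. x * s mod n) ` {..<n} = {..<n}"
    using False by (intro endo_inj_surj) auto
  have "(\<lambda>x. x * s mod n) ` ({x. x * s mod n < c} \<inter> {0..<n}) = {..<c}"
  proof
    show "{..<c} \<subseteq> (\<lambda>x. x * s mod n) ` ({x. x * s mod n < c} \<inter> {0..<n})"
    proof
      fix r assume "r \<in> {..<c}"
      then have "r \<in> (\<lambda>x. x * s mod n) ` {..<n}" using c img by auto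
      then show "r \<in> (\<lambda>x. x * s mod n) ` ({x. x * s mod n < c} \<inter> {0..<n})"
        using \<open>r \<in> {..<c}\<close> by auto
    qed
  qed auto
  moreover have "inj_on (\<lambda>x. x * s mod n) ({x. x * s mod n < c} \<inter> {0..<n})"
    using inj by (rule inj_on_subset) auto
  ultimately show ?thesis unfolding cnt_def by (metis add_0 card_image card_lessThan)
qed (use c in simp)

lemma cnt_multiples_mod_ge:
  assumes cop: "coprime s n" and c: "c \<le> n" and n: "0 < n"
  shows "c * N \<le> n * cnt {x. x * s mod n < c} 0 N + n * c"
proof -
  let ?T = "{x. x * s mod n < c}"
  have "cnt ?T 0 (q * n) = q * c" for q
  proof (induction q)
    case (Suc q)
    have "(y + q * n) * s mod n = y * s mod n" for y
      by (simp add: algebra_simps)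
    then have "{y. y + q * n \<in> ?T} = ?T" by simp
    then have "cnt ?T (q * n) n = cnt ?T 0 n"
      using cnt_shift[of "q * n" ?T 0 n] by simp
    then show ?case
      using Suc cnt_multiples_mod[OF cop c] cnt_add[of ?T 0 "q * n" n] by (simp add: add.commute)
  qed simp
  then have "(N div n) * c \<le> cnt ?T 0 N"
    using cnt_add[of ?T 0 "N div n * n" "N mod n"] by simp
  then have "n * ((N div n) * c) \<le> n * cnt ?T 0 N" by (rule mult_le_mono2)
  moreover have "N \<le> n * (N div n) + n"
    using n by (metis add_le_cancel_left less_imp_le mod_less_divisor mult_div_mod_eq)
  then have "c * N \<le> c * (n * (N div n) + n)" by (rule mult_le_mono2)
  moreover have "c * (n * (N div n) + n) = n * ((N div n) * c) + n * c"
    by (simp add: algebra_simps)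
  ultimately show ?thesis by linarith
qed

text \<open>Turns the check of a rational angle into arithmetic with multiples of
  \<open>n\<close>.\<close>

lemma dist_nearest_int_fraction_ge:
  fixes a :: int
  assumes n: "0 < n" and ge: "\<And>l::int. int c \<le> \<bar>a - l * int n\<bar>"
  shows "real c \<le> real n * dist_nearest_int (of_int a / real n)"
proof -
  let ?l = "round (real_of_int a / real n)"
  have "real n * dist_nearest_int (of_int a / real n) = \<bar>real n * (of_int a / real n - of_int ?l)\<bar>"
    unfolding dist_nearest_int_def by (simp add: abs_mult)
  also have "real n * (of_int a / real n - of_int ?l) = of_int (a - ?l * int n)"
    using n by (simp add: field_simps)
  finally have "real n * dist_nearest_int (of_int a / real n) = of_int \<bar>a - ?l * int n\<bar>" by simp
  moreover have "real_of_int (int c) \<le> of_int \<bar>a - ?l * int n\<bar>"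
    using ge[of ?l] by (simp only: of_int_le_iff)
  ultimately show ?thesis by simp
qed

lemma abs_mult_minus_ge:
  fixes u c n :: int
  assumes "0 \<le> c" "2 * c \<le> n"
  shows "c \<le> \<bar>u * n - c\<bar>"
proof (cases "u \<le> 0")
  case True
  then have "u * n \<le> 0" using assms by (simp add: mult_nonpos_nonneg)
  then show ?thesis using assms by linarith
next
  case False
  then have "1 * n \<le> u * n" using assms by (intro mult_right_mono) auto
  then show ?thesis using assms by linarith
qed

section \<open>Both suprema are attained at the angle s / n\<close>

theorem theorem3:
  fixes j m k :: nat and D :: "nat set"
  assumes "even j" and "0 < j"
    and "1 \<le> m" and "m + 3 \<le> j"
    and "k = m * (j + 1) + 3"
    and "D = {1, j, k}"
  shows "mu D = kappa D \<and> kappa D = real (j * (m + 1)) / real (2 * (j + k))"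
proof -
  obtain h where j: "j = 2 * h" using \<open>even j\<close> by (auto elim: evenE)
  define M where "M = Suc m"
  define n where "n = M * (2 * h + 1) + 2"
  define c where "c = M * h"
  define s where "s = c + 1"
  have n: "0 < n" and cn: "2 * c \<le> n" "c \<le> n" and nM: "n = 2 * s + M"
    by (simp_all add: n_def c_def s_def algebra_simps)
  have jk: "n = j + k" using assms(5) by (simp add: n_def j M_def)
  have \<alpha>: "real (j * (m + 1)) / real (2 * (j + k)) = real c / real n"
    unfolding jk[symmetric] using n by (simp add: c_def j M_def field_simps)
  have D: "D = {1, 2 * h, m * (2 * h + 1) + 3}" using assms(5,6) j by simp

  have upper: "n * cnt S 0 N \<le> c * N + n * n" if "D_sequence D S" for S N
    using D_sequence_window_le[of h m S] that n assms(4) unfolding D n_def c_def M_def j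
    by (intro cnt_le_of_window) auto

  \<comment> \<open>\<open>2 s = n - m - 1\<close>, hence \<open>j s \<equiv> - c\<close> and \<open>k s \<equiv> - j s \<equiv> c\<close> modulo \<open>n\<close>.\<close>
  have js: "int j * int s = int h * int n - int c"
    unfolding j n_def s_def c_def by (simp add: algebra_simps)
  have dist_ge: "real c \<le> real n * dist_nearest_int (real s / real n * real d)" if "d \<in> D" for d
  proof -
    have "int c \<le> \<bar>int (d * s) - l * int n\<bar>" for l
    proof -
      consider "d = 1" | "d = j" | "d = k" using \<open>d \<in> D\<close> assms(6) by auto
      then show ?thesis
      proof cases
        case 1
        \<comment> \<open>\<open>s = c + 1\<close> lies between \<open>c\<close> and
          \<open>n - c\<close>, because \<open>n = 2 * s + M\<close>.\<close>
        show ?thesis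
        proof (cases "l \<le> 0")
          case True
          then have "l * int n \<le> 0" by (simp add: mult_nonpos_nonneg)
          then show ?thesis using 1 by (simp add: s_def)
        next
          case False
          then have "1 * int n \<le> l * int n" by (intro mult_right_mono) auto
          moreover have "int c + int s \<le> int n" using nM by (simp add: s_def M_def)
          ultimately show ?thesis using 1 by simp
        qed
      next
        case 2
        have "int (d * s) - l * int n = (int h - l) * int n - int c"
          using js 2 by (simp add: algebra_simps)
        then show ?thesis using abs_mult_minus_ge[of "int c" "int n" "int h - l"] cn by simp
      next
        case 3
        have "int k * int s = int n * int s - int j * int s"
          using jk by (simp add: algebra_simps)
        then have "int (d * s) - l * int n = - ((int h + l - int s) * int n - int c)"
          using js 3 by (simp add: algebra_simps)
        then show ?thesis using abs_mult_minus_ge[of "int c" "int n" "int h + l - int s"] cn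
          by simp
      qed
    qed
    from dist_nearest_int_fraction_ge[OF n this] show ?thesis by (simp add: mult.commute)
  qed

  have fin: "finite D" "D \<noteq> {}" by (simp_all add: D)
  have "kappa D = real c / real n"
    unfolding kappa_def
  proof (rule cSup_eq_maximum)
    have le: "Min ((\<lambda>d. dist_nearest_int (t * real d)) ` D) \<le> real c / real n" for t
    proof (rule uniform_dist_le[OF upper n])
      let ?A = "(\<lambda>d. dist_nearest_int (t * real d)) ` D"
      have A: "finite ?A" "?A \<noteq> {}" using fin by auto
      show "0 \<le> Min ?A" using A by (auto simp: dist_nearest_int_nonneg)
      have "Min ?A \<le> dist_nearest_int (t * real 1)" using A D by (intro Min_le) auto
      also have "\<dots> \<le> 1"
        using of_int_round_abs_le[of "t * real 1"] unfolding dist_nearest_int_def by linarith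
      finally show "Min ?A \<le> 1" .
      show "Min ?A \<le> dist_nearest_int (t * real d)" if "d \<in> D" for d
        using A that by (intro Min_le) auto
    qed
    then show "x \<le> real c / real n" if "x \<in> range (\<lambda>t. Min ((\<lambda>d. dist_nearest_int (t * real d)) ` D))" for x
      using that by auto
    have "real c / real n \<le> Min ((\<lambda>d. dist_nearest_int (real s / real n * real d)) ` D)"
      using fin dist_ge n by (auto simp: field_simps)
    with le have "real c / real n = Min ((\<lambda>d. dist_nearest_int (real s / real n * real d)) ` D)"
      by (intro antisym)
    then show "real c / real n \<in> range (\<lambda>t. Min ((\<lambda>d. dist_nearest_int (t * real d)) ` D))"
      by (rule range_eqI)
  qed
  moreover have "mu D = real c / real n"
    unfolding mu_def
  proof (rule cSup_eq_maximum)
    fix y assume "y \<in> {natural_density S |S. D_sequence D S \<and> has_density S}"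
    then obtain S where S: "D_sequence D S" "y = natural_density S" by blast
    \<comment> \<open>\<open>real_of_ereal\<close> sends infinities to 0; nonnegativity and a finite
      upper bound make the comparison valid.\<close>
    have "0 \<le> upper_density S"
      unfolding upper_density_def by (intro le_Limsup) (auto simp: zero_ereal_def)
    then show "y \<le> real c / real n"
      using real_of_ereal_positive_mono[OF _ upper_density_le[OF upper[OF S(1)] n]]
      by (simp add: S(2) natural_density_def)
  next
    \<comment> \<open>With \<open>n\<close> cells and angle \<open>s / n\<close> the floors in
      \<open>circle_D_sequence\<close> are exact.\<close>
    define T where "T = {x. x * s mod n < c}"
    have "T = {x. (\<lfloor>real n * real x * (real s / real n)\<rfloor> + 0) mod int n < int c}"
    proof -
      have "\<lfloor>real n * real x * (real s / real n)\<rfloor> = int (x * s)" for x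
        using n by (simp add: floor_eq_iff)
      moreover have "int (x * s) mod int n < int c \<longleftrightarrow> x * s mod n < c" for x
        by (simp only: of_nat_less_iff flip: of_nat_mod)
      ultimately show ?thesis unfolding T_def by simp
    qed
    then have T: "D_sequence D T"
      using circle_D_sequence[OF n, of D c "real s / real n" 0] dist_ge by simp
    \<comment> \<open>A common divisor of \<open>s\<close> and \<open>n = 2 * s + M\<close> divides
      \<open>M\<close>, hence \<open>c = M * h\<close>, hence \<open>s - c = 1\<close>.\<close>
    have "coprime s n"
    proof (rule coprimeI)
      fix g assume g: "g dvd s" "g dvd n"
      then have "g dvd M" by (simp add: nM dvd_add_right_iff)
      then have "g dvd c" by (simp add: c_def)
      with g(1) show "is_unit g"
        unfolding s_def by (simp only: dvd_add_right_iff)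
    qed
    then have "ereal (real c / real n) \<le> lower_density T"
      unfolding T_def using cn n by (intro lower_density_ge cnt_multiples_mod_ge)
    moreover have "lower_density T \<le> upper_density T"
      unfolding lower_density_def upper_density_def by (intro Liminf_le_Limsup) simp
    moreover have "upper_density T \<le> ereal (real c / real n)"
      by (rule upper_density_le[OF upper[OF T] n])
    ultimately have "lower_density T = ereal (real c / real n)" "upper_density T = ereal (real c / real n)"
      by auto
    then have "has_density T" "natural_density T = real c / real n"
      by (simp_all add: has_density_def natural_density_def)
    with T show "real c / real n \<in> {natural_density S |S. D_sequence D S \<and> has_density S}"
      by (auto intro!: exI[of _ T])
  qed
  ultimately show ?thesis using \<alpha> by simp
qed

end
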